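(* Let $N=(G,f)$ be a Boolean network and $I$ a non-empty proper subset of $V(G)$ such that $G$ has no edge from a vertex of $V(G)\setminus I$ to a vertex of $I$. Identify $\{0,1\}^{V(G)}$ with $\{0,1\}^I\times\{0,1\}^{V(G)\setminus I}$. Then $$\mathcal{A}(N)=\{a\times b\mid a\in\mathcal{A}(N[I]),\ b\in\mathcal{A}(N(I,a))\},$$ and consequently $\mathcal{A}(N)$ is in bijection with the dependent sum $\sum_{a\in\mathcal{A}(N[I])}\mathcal{A}(N(I,a))=\{(a,b)\mid a\in\mathcal{A}(N[I]),\ b\in\mathcal{A}(N(I,a))\}$.
   Context: Let $\mathbb{B}=\{0,1\}$. A Boolean network is a pair $N=(G,f)$ where $G$ is a finite directed graph and $f=(f_v)_{v\in V(G)}$ with $f_v:\mathbb{B}^{G^-(v)}\to\mathbb{B}$, $G^-(v)$ the in-neighbourhood of $v$ ($f_v$ need not depend on all in-neighbours). The asynchronous state transition graph $\mathrm{ASTG}(N)$ has vertex set $\mathbb{B}^{V(G)}$ and an edge from $x$ to $y$ iff $x,y$ differ in exactly one coordinate $v$ and $f_v(x\restriction G^-(v))=y_v\neq x_v$; Boolean networks on a given vertex set are identified with such partial orientations of the hypercube. The (asynchronous) attractors of $N$ are the terminal strongly connected components of $\mathrm{ASTG}(N)$, viewed as sets of states; $\mathcal{A}(N)$ is the set of attractors. $N[I]=(G[I],(f_v)_{v\in I})$. For $x\in\mathbb{B}^I$ and $v\in V(G)\setminus I$, $f^x_v(y)=f_v(z)$ where $z\in\mathbb{B}^{G^-(v)}$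 agrees with $x$ on $G^-(v)\cap I$ and with $y$ on $G^-(v)\setminus I$, and $N(I,x)=(G[V(G)\setminus I],(f^x_v)_{v\in V(G)\setminus I})$. For $a\subseteq\mathbb{B}^I$, $N(I,a)$ is the unique Boolean network on $V(G)\setminus I$ whose asynchronous state transition graph is the edge union of the graphs $\mathrm{ASTG}(N(I,x))$, $x\in a$. *)

theory Defs
  imports "Graph_Theory.Graph_Theory" "HOL-Library.FuncSet"
begin

definition in_nbrs :: "'v pair_pre_digraph \<Rightarrow> 'v \<Rightarrow> 'v set" where
  "in_nbrs G v = {u. (u, v) \<in> parcs G}"

definition induced :: "'v pair_pre_digraph \<Rightarrow> 'v set \<Rightarrow> 'v pair_pre_digraph" where
  "induced G I = \<lparr>pverts = I, parcs = parcs G \<inter> I \<times> I\<rparr>"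

lemma with_proj_induced: "with_proj (induced G I) = with_proj G \<restriction> I"
  by (auto simp: induced_def with_proj_def induce_subgraph_def)

definition states :: "'v set \<Rightarrow> ('v \<Rightarrow> bool) set" where
  "states V = PiE V (\<lambda>_. UNIV)"

text \<open>
  Loops are allowed in the graph. The local function of \<open>v\<close> is only ever applied to elements of
  \<open>states (in_nbrs G v)\<close>; its values elsewhere play no role.
\<close>

record 'v bool_net =
  net_graph :: "'v pair_pre_digraph"
  net_fun :: "'v \<Rightarrow> ('v \<Rightarrow> bool) \<Rightarrow> bool"

abbreviation net_verts :: "'v bool_net \<Rightarrow> 'v set" where
  "net_verts N \<equiv> pverts (net_graph N)"

definition boolean_network :: "'v bool_net \<Rightarrow> bool" where
  "boolean_network N \<longleftrightarrow> pair_fin_digraph (net_graph N)"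

definition astg :: "'v bool_net \<Rightarrow> ('v \<Rightarrow> bool) pair_pre_digraph" where
  "astg N = \<lparr>pverts = states (net_verts N),
     parcs = {(x, y). x \<in> states (net_verts N) \<and> y \<in> states (net_verts N) \<and>
       (\<exists>v. {u \<in> net_verts N. x u \<noteq> y u} = {v} \<and>
            net_fun N v (restrict x (in_nbrs (net_graph N) v)) = y v \<and> y v \<noteq> x v)}\<rparr>"

definition attractors :: "'v bool_net \<Rightarrow> ('v \<Rightarrow> bool) set set" where
  "attractors N = verts ` {C \<in> pre_digraph.sccs (with_proj (astg N)).
     \<forall>(x, y) \<in> parcs (astg N). x \<in> verts C \<longrightarrow> y \<in> verts C}"

definition subnet :: "'v bool_net \<Rightarrow> 'v set \<Rightarrow> 'v bool_net" where
  "subnet N I = \<lparr>net_graph = induced (net_graph N) I, net_fun = net_fun N\<rparr>"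

definition fix_state :: "'v bool_net \<Rightarrow> 'v set \<Rightarrow> ('v \<Rightarrow> bool) \<Rightarrow> 'v bool_net" where
  "fix_state N I x = \<lparr>net_graph = induced (net_graph N) (net_verts N - I),
     net_fun = (\<lambda>v y. net_fun N v (restrict (override_on y x I) (in_nbrs (net_graph N) v)))\<rparr>"

text \<open>
  A network is identified with its asynchronous state transition graph, a partial orientation of
  the hypercube (an edge of the hypercube may be oriented in both directions). The network
  belonging to a partial orientation \<open>T\<close> is represented on the complete digraph with loops; the
  lemmas \<open>astg_net_of\<close> and \<open>astg_determines_fun\<close> show that it has transition graph \<open>T\<close> and that
  the transition graph determines the local functions.
\<close>

definition partial_orientation :: "'v set \<Rightarrow> ('v \<Rightarrow> bool) pair_pre_digraph \<Rightarrow> bool" where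
  "partial_orientation J T \<longleftrightarrow> pverts T = states J \<and>
     parcs T \<subseteq> {(x, y). x \<in> states J \<and> y \<in> states J \<and> (\<exists>v. {u \<in> J. x u \<noteq> y u} = {v})}"

definition net_of :: "'v set \<Rightarrow> ('v \<Rightarrow> bool) pair_pre_digraph \<Rightarrow> 'v bool_net" where
  "net_of J T = \<lparr>net_graph = \<lparr>pverts = J, parcs = J \<times> J\<rparr>,
     net_fun = (\<lambda>v y. if (y, y(v := \<not> y v)) \<in> parcs T then \<not> y v else y v)\<rparr>"

definition fix_states :: "'v bool_net \<Rightarrow> 'v set \<Rightarrow> ('v \<Rightarrow> bool) set \<Rightarrow> 'v bool_net" where
  "fix_states N I a = net_of (net_verts N - I)
     \<lparr>pverts = states (net_verts N - I), parcs = (\<Union>x\<in>a. parcs (astg (fix_state N I x)))\<rparr>"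

text \<open>
  The identification of \<open>states I \<times> states (V - I)\<close> with \<open>states V\<close> sends \<open>(x, y)\<close> to
  \<open>override_on y x I\<close>; see \<open>bij_betw_glue\<close>.
\<close>

definition state_prod :: "'v set \<Rightarrow> ('v \<Rightarrow> bool) set \<Rightarrow> ('v \<Rightarrow> bool) set \<Rightarrow> ('v \<Rightarrow> bool) set" where
  "state_prod I a b = (\<lambda>(x, y). override_on y x I) ` (a \<times> b)"

lemma bij_betw_glue:
  assumes "I \<subseteq> V"
  shows "bij_betw (\<lambda>(x, y). override_on y x I) (states I \<times> states (V - I)) (states V)"
proof (rule bij_betw_byWitness[where f' = "\<lambda>z. (restrict z I, restrict z (V - I))"])
  show "\<forall>p \<in> states I \<times> states (V - I).
      (\<lambda>z. (restrict z I, restrict z (V - I))) ((\<lambda>(x, y). override_on y x I) p) = p"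
    unfolding states_def by (auto simp: fun_eq_iff restrict_apply override_on_def PiE_def extensional_def split: if_splits)
  show "\<forall>z \<in> states V. (\<lambda>(x, y). override_on y x I) (restrict z I, restrict z (V - I)) = z"
    using assms unfolding states_def
    by (auto simp: fun_eq_iff restrict_apply override_on_def PiE_def extensional_def split: if_splits)
  show "(\<lambda>(x, y). override_on y x I) ` (states I \<times> states (V - I)) \<subseteq> states V"
    using assms unfolding states_def by (auto simp: override_on_def PiE_def extensional_def)
  show "(\<lambda>z. (restrict z I, restrict z (V - I))) ` states V \<subseteq> states I \<times> states (V - I)"
    unfolding states_def by auto
qed

lemma flip_in_states: "x \<in> states J \<Longrightarrow> v \<in> J \<Longrightarrow> x(v := b) \<in> states J"
  by (auto simp: states_def PiE_def extensional_def)

lemma differ_once: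
  assumes "x \<in> states J" "y \<in> states J"
  shows "{u \<in> J. x u \<noteq> y u} = {v} \<longleftrightarrow> v \<in> J \<and> y = x(v := \<not> x v)"
proof
  assume *: "{u \<in> J. x u \<noteq> y u} = {v}"
  then have "v \<in> {u \<in> J. x u \<noteq> y u}" by (simp only: singletonI)
  then have v: "v \<in> J" "x v \<noteq> y v" by simp_all
  have "y u = (x(v := \<not> x v)) u" for u
  proof (cases "u = v")
    case True
    then show ?thesis using v by simp
  next
    case neq: False
    show ?thesis
    proof (cases "u \<in> J")
      case True
      have "u \<notin> {u \<in> J. x u \<noteq> y u}" unfolding * using neq by simp
      then show ?thesis using True neq by simp
    next
      case False
      then show ?thesis using assms neq PiE_arb unfolding states_def by (metis fun_upd_other)
    qed
  qed
  then have "y = x(v := \<not> x v)" by (rule ext)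
  with v show "v \<in> J \<and> y = x(v := \<not> x v)" by (simp only: simp_thms)
next
  assume "v \<in> J \<and> y = x(v := \<not> x v)"
  then have "v \<in> J" "y = x(v := \<not> x v)" by blast+
  show "{u \<in> J. x u \<noteq> y u} = {v}"
    unfolding \<open>y = x(v := \<not> x v)\<close> using \<open>v \<in> J\<close> by (auto split: if_splits)
qed

lemma arc_astg_iff:
  "(x, y) \<in> parcs (astg N) \<longleftrightarrow> x \<in> states (net_verts N) \<and>
     (\<exists>v \<in> net_verts N. y = x(v := \<not> x v) \<and>
        net_fun N v (restrict x (in_nbrs (net_graph N) v)) \<noteq> x v)"
proof
  assume "(x, y) \<in> parcs (astg N)"
  then show "x \<in> states (net_verts N) \<and> (\<exists>v \<in> net_verts N. y = x(v := \<not> x v) \<and>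
        net_fun N v (restrict x (in_nbrs (net_graph N) v)) \<noteq> x v)"
    unfolding astg_def using differ_once[of x "net_verts N" y] by auto
next
  assume "x \<in> states (net_verts N) \<and> (\<exists>v \<in> net_verts N. y = x(v := \<not> x v) \<and>
        net_fun N v (restrict x (in_nbrs (net_graph N) v)) \<noteq> x v)"
  then obtain v where v: "x \<in> states (net_verts N)" "v \<in> net_verts N" "y = x(v := \<not> x v)"
      "net_fun N v (restrict x (in_nbrs (net_graph N) v)) \<noteq> x v" by blast
  then have y: "y \<in> states (net_verts N)" by (simp add: flip_in_states)
  have "y v \<noteq> x v" unfolding v(3) by simp
  moreover from this v(4)
  have "net_fun N v (restrict x (in_nbrs (net_graph N) v)) = y v" by blast
  moreover have "{u \<in> net_verts N. x u \<noteq> y u} = {v}"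
    using differ_once[OF v(1) y, of v] v(2,3) by blast
  ultimately show "(x, y) \<in> parcs (astg N)" using v(1) y unfolding astg_def by auto
qed

lemma partial_orientation_astg: "partial_orientation (net_verts N) (astg N)"
  by (auto simp: partial_orientation_def astg_def)

lemma astg_net_of:
  assumes "partial_orientation J T"
  shows "astg (net_of J T) = T"
proof -
  have restr: "restrict x (in_nbrs \<lparr>pverts = J, parcs = J \<times> J\<rparr> v) = x"
    if "x \<in> states J" "v \<in> J" for x v
    using that by (auto simp: in_nbrs_def states_def PiE_def extensional_restrict)
  have "parcs (astg (net_of J T)) = parcs T"
  proof (rule set_eqI, clarify)
    fix x y
    have "(x, y) \<in> parcs (astg (net_of J T)) \<longleftrightarrow>
        x \<in> states J \<and> (\<exists>v\<in>J. y = x(v := \<not> x v) \<and> (x, x(v := \<not> x v)) \<in> parcs T)"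
      unfolding arc_astg_iff by (simp add: net_of_def restr cong: conj_cong bex_cong) blast
    also have "\<dots> \<longleftrightarrow> (x, y) \<in> parcs T"
    proof
      assume xy: "(x, y) \<in> parcs T"
      then obtain v where "x \<in> states J" "y \<in> states J" "{u \<in> J. x u \<noteq> y u} = {v}"
        using assms unfolding partial_orientation_def by blast
      then show "x \<in> states J \<and> (\<exists>v\<in>J. y = x(v := \<not> x v) \<and> (x, x(v := \<not> x v)) \<in> parcs T)"
        using xy differ_once[of x J y v] by blast
    qed auto
    finally show "(x, y) \<in> parcs (astg (net_of J T)) \<longleftrightarrow> (x, y) \<in> parcs T" .
  qed
  moreover have "pverts (astg (net_of J T)) = pverts T"
    using assms by (simp add: partial_orientation_def astg_def net_of_def)
  ultimately show ?thesis by simp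
qed

lemma astg_determines_fun:
  assumes "net_verts M = net_verts N" "astg M = astg N" "v \<in> net_verts N" "x \<in> states (net_verts N)"
  shows "net_fun M v (restrict x (in_nbrs (net_graph M) v)) =
    net_fun N v (restrict x (in_nbrs (net_graph N) v))"
proof -
  have flip_inj: "v = w" if "x(v := \<not> x v) = x(w := \<not> x w)" for w
    using that by (metis fun_upd_apply)
  have "(x, x(v := \<not> x v)) \<in> parcs (astg L) \<longleftrightarrow>
      net_fun L v (restrict x (in_nbrs (net_graph L) v)) \<noteq> x v"
    if "net_verts L = net_verts N" for L
    using assms(3,4) flip_inj unfolding arc_astg_iff that by blast
  from this[of M] this[of N] assms(1,2) show ?thesis by auto
qed

lemma astg_fix_states:
  "astg (fix_states N I a) = \<lparr>pverts = states (net_verts N - I),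
     parcs = (\<Union>x\<in>a. parcs (astg (fix_state N I x)))\<rparr>"
  unfolding fix_states_def
proof (rule astg_net_of)
  have "net_verts (fix_state N I x) = net_verts N - I" for x
    by (simp add: fix_state_def induced_def)
  then show "partial_orientation (net_verts N - I) \<lparr>pverts = states (net_verts N - I),
      parcs = (\<Union>x\<in>a. parcs (astg (fix_state N I x)))\<rparr>"
    using partial_orientation_astg[of "fix_state N I _"]
    unfolding partial_orientation_def by (simp add: UN_least)
qed

lemma boolean_network_subnet:
  "boolean_network N \<Longrightarrow> I \<subseteq> net_verts N \<Longrightarrow> boolean_network (subnet N I)"
  by (auto simp: boolean_network_def pair_fin_digraph_def pair_fin_digraph_axioms_def
      pair_wf_digraph_def subnet_def induced_def intro: finite_subset)

lemma boolean_network_fix_state: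
  "boolean_network N \<Longrightarrow> boolean_network (fix_state N I x)"
  by (auto simp: boolean_network_def pair_fin_digraph_def pair_fin_digraph_axioms_def
      pair_wf_digraph_def fix_state_def induced_def)

lemma boolean_network_fix_states:
  "boolean_network N \<Longrightarrow> boolean_network (fix_states N I a)"
  by (auto simp: boolean_network_def pair_fin_digraph_def pair_fin_digraph_axioms_def
      pair_wf_digraph_def fix_states_def net_of_def)

end

theory Submission
  imports Defs
begin

text \<open>
  Since no arc enters \<open>I\<close>, the transition graph of \<open>N\<close> is a skew product: a step either moves the
  \<open>I\<close>-part by a step of the subnetwork, whatever the other part is, or moves the other part by a step
  that depends on the \<open>I\<close>-part. An attractor \<open>A\<close> therefore projects onto an attractor \<open>a\<close> of the
  base, and as the base moves freely, \<open>A\<close> is a full product \<open>a \<times> b\<close>. Within it every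
  \<open>x \<in> a\<close> can be reached before the next fibre step, so the fibre part sees exactly the union of
  the transition graphs over \<open>x \<in> a\<close>.
\<close>

section \<open>Terminal strong components as closed, mutually reachable sets\<close>

text \<open>Closedness stands in for the maximality of a strong component: no path leaves the set,
  so no outside point is mutually reachable with it. As \<open>E\<^sup>*\<close> is reflexive, a
  single point without outgoing arcs qualifies.\<close>

definition terminal_class :: "'a rel \<Rightarrow> 'a set \<Rightarrow> bool" where
  "terminal_class E A \<longleftrightarrow> A \<noteq> {} \<and> (\<forall>x\<in>A. \<forall>y. (x, y) \<in> E \<longrightarrow> y \<in> A) \<and> (\<forall>x\<in>A. \<forall>y\<in>A. (x, y) \<in> E\<^sup>*)"

lemma terminal_class_nonempty: "terminal_class E A \<Longrightarrow> A \<noteq> {}"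
  by (simp add: terminal_class_def)

lemma terminal_class_closed: "terminal_class E A \<Longrightarrow> x \<in> A \<Longrightarrow> (x, y) \<in> E \<Longrightarrow> y \<in> A"
  by (auto simp: terminal_class_def)

lemma terminal_class_connected: "terminal_class E A \<Longrightarrow> x \<in> A \<Longrightarrow> y \<in> A \<Longrightarrow> (x, y) \<in> E\<^sup>*"
  by (auto simp: terminal_class_def)

lemma terminal_class_closed_rtrancl:
  assumes "(x, y) \<in> E\<^sup>*" "terminal_class E A" "x \<in> A"
  shows "y \<in> A"
  using assms(1,3) by induction (auto intro: terminal_class_closed[OF assms(2)])

lemma terminal_sccs_eq:
  assumes "pair_wf_digraph G"
  shows "verts ` {C \<in> pre_digraph.sccs (with_proj G). \<forall>(x, y) \<in> parcs G. x \<in> verts C \<longrightarrow> y \<in> verts C}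
    = {A. A \<subseteq> pverts G \<and> terminal_class (parcs G) A}"
proof -
  interpret pair_wf_digraph G by fact
  \<comment> \<open>Reachability in the digraph holds only between vertices, so the empty path at a
    point outside \<open>pverts G\<close> has to be excluded.\<close>
  have reach: "u \<rightarrow>\<^sup>*\<^bsub>with_proj G\<^esub> v \<longleftrightarrow> (u, v) \<in> (parcs G)\<^sup>* \<and> u \<in> pverts G \<and> v \<in> pverts G" for u v
    using reachable_conv[of u v] by auto
  have "A \<in> sccs_verts \<and> (\<forall>(x, y) \<in> parcs G. x \<in> A \<longrightarrow> y \<in> A) \<longleftrightarrow>
      A \<subseteq> pverts G \<and> terminal_class (parcs G) A" for A
  proof
    assume "A \<in> sccs_verts \<and> (\<forall>(x, y) \<in> parcs G. x \<in> A \<longrightarrow> y \<in> A)"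
    then show "A \<subseteq> pverts G \<and> terminal_class (parcs G) A"
      unfolding in_sccs_verts_conv_reachable reach terminal_class_def by blast
  next
    assume A: "A \<subseteq> pverts G \<and> terminal_class (parcs G) A"
    \<comment> \<open>Maximality of the component: whatever is reachable from \<open>A\<close>
      already lies in \<open>A\<close>.\<close>
    then have "v \<in> A" if "u \<in> A" "(u, v) \<in> (parcs G)\<^sup>*" for u v
      using that terminal_class_closed_rtrancl by metis
    with A show "A \<in> sccs_verts \<and> (\<forall>(x, y) \<in> parcs G. x \<in> A \<longrightarrow> y \<in> A)"
      unfolding in_sccs_verts_conv_reachable reach terminal_class_def by blast
  qed
  moreover have "verts ` {C \<in> sccs. \<forall>(x, y) \<in> parcs G. x \<in> verts C \<longrightarrow> y \<in> verts C} =
      {A \<in> sccs_verts. \<forall>(x, y) \<in> parcs G. x \<in> A \<longrightarrow> y \<in> A}"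
    unfolding sccs_verts_conv by blast
  ultimately show ?thesis by simp
qed

lemma attractors_eq:
  "attractors N = {A. A \<subseteq> states (net_verts N) \<and> terminal_class (parcs (astg N)) A}"
proof -
  have "pair_wf_digraph (astg N)"
    unfolding pair_wf_digraph_def astg_def by simp
  from terminal_sccs_eq[OF this] show ?thesis
    unfolding attractors_def by (simp add: astg_def)
qed

section \<open>Terminal classes of an abstract skew product\<close>

text \<open>
  \<open>F\<close> is the relation on the base \<open>S\<close>, \<open>G x\<close> the relation on the fibre \<open>T\<close> over \<open>x\<close>, and \<open>E\<close> the
  relation on the total space, whose points are the \<open>g x y\<close>.
\<close>

locale skew_product =
  fixes S :: "'x set" and T :: "'y set" and F :: "'x rel" and G :: "'x \<Rightarrow> 'y rel"
    and E :: "'z rel" and g :: "'x \<Rightarrow> 'y \<Rightarrow> 'z"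
  assumes F_sub: "F \<subseteq> S \<times> S"
    and G_sub: "\<And>x. G x \<subseteq> T \<times> T"
    and base_step: "\<And>x x' y. (x, x') \<in> F \<Longrightarrow> y \<in> T \<Longrightarrow> (g x y, g x' y) \<in> E"
    and fibre_step: "\<And>x y y'. (y, y') \<in> G x \<Longrightarrow> x \<in> S \<Longrightarrow> (g x y, g x y') \<in> E"
    and step_cases: "\<And>x y z. (g x y, z) \<in> E \<Longrightarrow> x \<in> S \<Longrightarrow> y \<in> T \<Longrightarrow>
      (\<exists>x'. (x, x') \<in> F \<and> z = g x' y) \<or> (\<exists>y'. (y, y') \<in> G x \<and> z = g x y')"
    and g_inj: "inj_on (\<lambda>(x, y). g x y) (S \<times> T)"
begin

lemma g_eqD: "g x y = g x' y' \<Longrightarrow> x \<in> S \<Longrightarrow> x' \<in> S \<Longrightarrow> y \<in> T \<Longrightarrow> y' \<in> T \<Longrightarrow> x = x' \<and> y = y'"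
  using inj_onD[OF g_inj, of "(x, y)" "(x', y')"] by simp

lemma base_path: "(x, x') \<in> F\<^sup>* \<Longrightarrow> y \<in> T \<Longrightarrow> (g x y, g x' y) \<in> E\<^sup>*"
  by (induction rule: rtrancl_induct) (auto intro: base_step rtrancl.rtrancl_into_rtrancl)

text \<open>Induction on the fibre path with the final base point \<open>x'\<close> arbitrary: the
  next step belongs to \<open>G w\<close> for some \<open>w\<close> in \<open>a\<close>, so the
  induction hypothesis is taken with end point \<open>w\<close>, the step is made over
  \<open>w\<close>, and a base path then leads on to \<open>x'\<close>.\<close>

lemma fibre_path:
  assumes a: "terminal_class F a" "a \<subseteq> S"
    and path: "(y, y') \<in> (\<Union>x\<in>a. G x)\<^sup>*" "y \<in> T" and x: "x \<in> a" "x' \<in> a"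
  shows "(g x y, g x' y') \<in> E\<^sup>*"
  using path x(2)
proof (induction arbitrary: x' rule: rtrancl_induct)
  case base
  then show ?case using base_path terminal_class_connected[OF a(1)] x(1) by blast
next
  case (step u v)
  then obtain w where w: "w \<in> a" "(u, v) \<in> G w" by blast
  then have v: "v \<in> T" using G_sub by blast
  have "(g x y, g w u) \<in> E\<^sup>*" using step.IH step.prems(1) w(1) by blast
  also have "(g w u, g w v) \<in> E" using w a(2) by (auto intro: fibre_step)
  also have "(g w v, g x' v) \<in> E\<^sup>*"
    using base_path v terminal_class_connected[OF a(1)] w(1) step.prems(2) by blast
  finally show ?case .
qed

text \<open>A path that starts in \<open>A\<close> never leaves it. Carrying
  \<open>z \<in> A\<close> through the induction keeps the current base point in the projection of
  \<open>A\<close>, which is why the union need not range over all of \<open>S\<close>.\<close>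

lemma path_projections:
  assumes "(g x y, z) \<in> E\<^sup>*" and A: "terminal_class E A" "g x y \<in> A" and "x \<in> S" "y \<in> T"
  shows "\<exists>x'\<in>S. \<exists>y'\<in>T. z = g x' y' \<and> z \<in> A \<and> (x, x') \<in> F\<^sup>* \<and>
    (y, y') \<in> (\<Union>x\<in>{x\<in>S. \<exists>y\<in>T. g x y \<in> A}. G x)\<^sup>*"
  using assms(1)
proof (induction rule: rtrancl_induct)
  case base
  then show ?case using assms by auto
next
  case (step u v)
  let ?G = "\<Union>x\<in>{x\<in>S. \<exists>y\<in>T. g x y \<in> A}. G x"
  obtain p q where u: "p \<in> S" "q \<in> T" "u = g p q" "u \<in> A" "(x, p) \<in> F\<^sup>*" "(y, q) \<in> ?G\<^sup>*"
    using step.IH by blast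
  have v: "v \<in> A" using terminal_class_closed[OF A(1) u(4) step.hyps(2)] .
  consider (b) p' where "(p, p') \<in> F" "v = g p' q" | (f) q' where "(q, q') \<in> G p" "v = g p q'"
    using step_cases[of p q v] step.hyps(2) u by blast
  then show ?case
  proof cases
    case b
    then have "p' \<in> S" "(x, p') \<in> F\<^sup>*"
      using F_sub u(5) by (auto intro: rtrancl.rtrancl_into_rtrancl)
    then show ?thesis using b u v by blast
  next
    case f
    then have "(q, q') \<in> ?G" "q' \<in> T" using u G_sub by blast+
    then have "(y, q') \<in> ?G\<^sup>*" using u(6) by (meson rtrancl.rtrancl_into_rtrancl)
    then show ?thesis using f u v \<open>q' \<in> T\<close> by blast
  qed
qed

text \<open>A base step stays in \<open>a\<close>, and a fibre step over a point of \<open>a\<close>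
  belongs to the union, so it stays in \<open>b\<close>; \<open>fibre_path\<close> connects any two
  points.\<close>

lemma terminal_class_product:
  assumes a: "terminal_class F a" "a \<subseteq> S" and b: "terminal_class (\<Union>x\<in>a. G x) b" "b \<subseteq> T"
  shows "terminal_class E ((\<lambda>(x, y). g x y) ` (a \<times> b))"
  unfolding terminal_class_def
proof (intro conjI ballI allI impI)
  show "(\<lambda>(x, y). g x y) ` (a \<times> b) \<noteq> {}"
    using terminal_class_nonempty[OF a(1)] terminal_class_nonempty[OF b(1)] by auto
next
  fix u v assume "u \<in> (\<lambda>(x, y). g x y) ` (a \<times> b)" and uv: "(u, v) \<in> E"
  then obtain x y where u: "x \<in> a" "y \<in> b" "u = g x y" by auto
  then have "(\<exists>x'. (x, x') \<in> F \<and> v = g x' y) \<or> (\<exists>y'. (y, y') \<in> G x \<and> v = g x y')"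
    using step_cases uv a(2) b(2) by blast
  then show "v \<in> (\<lambda>(x, y). g x y) ` (a \<times> b)"
    using terminal_class_closed[OF a(1) u(1)] terminal_class_closed[OF b(1) u(2)] u by fast
next
  fix u v assume "u \<in> (\<lambda>(x, y). g x y) ` (a \<times> b)" "v \<in> (\<lambda>(x, y). g x y) ` (a \<times> b)"
  then show "(u, v) \<in> E\<^sup>*"
    using fibre_path[OF a] terminal_class_connected[OF b(1)] b(2) by auto
qed

text \<open>The factors are the two projections of \<open>A\<close>. That they are connected follows
  by projecting paths; the crucial point is that \<open>A\<close> contains every pair from
  them.\<close>

lemma terminal_class_is_product:
  assumes A: "terminal_class E A" "A \<subseteq> (\<lambda>(x, y). g x y) ` (S \<times> T)"
  shows "\<exists>a b. A = (\<lambda>(x, y). g x y) ` (a \<times> b) \<and> a \<subseteq> S \<and> terminal_class F a \<and>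
    b \<subseteq> T \<and> terminal_class (\<Union>x\<in>a. G x) b"
proof -
  define a where "a = {x\<in>S. \<exists>y\<in>T. g x y \<in> A}"
  define b where "b = {y\<in>T. \<exists>x\<in>S. g x y \<in> A}"
  have ab: "a \<subseteq> S" "b \<subseteq> T" by (auto simp: a_def b_def)
  have paths: "(x, x') \<in> F\<^sup>* \<and> (y, y') \<in> (\<Union>x\<in>a. G x)\<^sup>*"
    if "g x y \<in> A" "g x' y' \<in> A" "x \<in> S" "x' \<in> S" "y \<in> T" "y' \<in> T" for x x' y y'
  proof -
    have "(g x y, g x' y') \<in> E\<^sup>*" using terminal_class_connected[OF A(1)] that by blast
    \<comment> \<open>Injectivity of \<open>g\<close> identifies the coordinates found for the end
      point with \<open>x'\<close> and \<open>y'\<close>.\<close>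
    from path_projections[OF this A(1) that(1,3,5)] show ?thesis
      unfolding a_def using g_eqD that by blast
  qed
  \<comment> \<open>Some \<open>g x' y\<close> lies in \<open>A\<close>. A base path from
    \<open>x'\<close> to \<open>x\<close> lifts with \<open>y\<close> held fixed, and its end
    \<open>g x y\<close> is in \<open>A\<close> because \<open>A\<close> is closed.\<close>
  have full: "g x y \<in> A" if xy: "x \<in> a" "y \<in> b" for x y
  proof -
    obtain x' y' where wit: "x' \<in> S" "g x' y \<in> A" "y' \<in> T" "g x y' \<in> A"
      using xy unfolding a_def b_def by blast
    then have "(x', x) \<in> F\<^sup>*" using paths[of x' y x y'] xy ab by blast
    then have "(g x' y, g x y) \<in> E\<^sup>*" using base_path xy(2) ab by blast
    then show ?thesis using terminal_class_closed_rtrancl A(1) wit(2) by metis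
  qed
  have split: "\<exists>x\<in>a. \<exists>y\<in>b. z = g x y" if "z \<in> A" for z
    using that A(2) unfolding a_def b_def by fast
  have A_eq: "A = (\<lambda>(x, y). g x y) ` (a \<times> b)"
    using full split by fast
  have "a \<noteq> {}" "b \<noteq> {}" using terminal_class_nonempty[OF A(1)] A_eq by auto
  have "terminal_class F a"
    unfolding terminal_class_def
  proof (intro conjI ballI allI impI)
    fix x x' assume x: "x \<in> a" "(x, x') \<in> F"
    then obtain y where "y \<in> T" "g x y \<in> A" by (auto simp: a_def)
    then have "g x' y \<in> A" using terminal_class_closed[OF A(1)] base_step x(2) by blast
    then show "x' \<in> a" using x(2) F_sub \<open>y \<in> T\<close> by (auto simp: a_def)
  next
    fix x x' assume "x \<in> a" "x' \<in> a"
    then show "(x, x') \<in> F\<^sup>*" using paths by (auto simp: a_def)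
  qed fact
  moreover have "terminal_class (\<Union>x\<in>a. G x) b"
    unfolding terminal_class_def
  proof (intro conjI ballI allI impI)
    fix y y' assume y: "y \<in> b" "(y, y') \<in> (\<Union>x\<in>a. G x)"
    then obtain x where x: "x \<in> a" "(y, y') \<in> G x" by blast
    then have "(g x y, g x y') \<in> E" using fibre_step ab by blast
    \<comment> \<open>Fullness is essential here: \<open>y \<in> b\<close> only promises a point of
      \<open>A\<close> over some base point, perhaps not over the \<open>x\<close> whose fibre
      relation has the arc.\<close>
    then have "g x y' \<in> A" using terminal_class_closed[OF A(1)] full x(1) y(1) by blast
    then show "y' \<in> b" using x ab G_sub by (auto simp: b_def)
  next
    fix y y' assume "y \<in> b" "y' \<in> b"
    then show "(y, y') \<in> (\<Union>x\<in>a. G x)\<^sup>*" using paths by (auto simp: b_def)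
  qed fact
  ultimately show ?thesis using A_eq ab by blast
qed

end

section \<open>The transition graph of a network as a skew product\<close>

lemma net_verts_subnet [simp]: "net_verts (subnet N I) = I"
  by (simp add: subnet_def induced_def)

lemma net_verts_fix_state [simp]: "net_verts (fix_state N I x) = net_verts N - I"
  by (simp add: fix_state_def induced_def)

lemma net_verts_fix_states [simp]: "net_verts (fix_states N I a) = net_verts N - I"
  by (simp add: fix_states_def net_of_def)

lemma glue_in_states:
  assumes "I \<subseteq> V" "x \<in> states I" "y \<in> states (V - I)"
  shows "override_on y x I \<in> states V"
  using bij_betw_apply[OF bij_betw_glue[OF assms(1)], of "(x, y)"] assms(2,3) by simp

lemma override_on_upd_in: "v \<in> I \<Longrightarrow> (override_on y x I)(v := c) = override_on y (x(v := c)) I"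
  by (auto simp: override_on_def)

lemma override_on_upd_notin: "v \<notin> I \<Longrightarrow> (override_on y x I)(v := c) = override_on (y(v := c)) x I"
  by (auto simp: override_on_def)

text \<open>All in-neighbours of a vertex of \<open>I\<close> lie in \<open>I\<close>, so its local
  function ignores the part \<open>y\<close>, which may be chosen freely.\<close>

lemma arc_subnet_iff:
  assumes "boolean_network N" "I \<subseteq> net_verts N"
    and "\<forall>u \<in> net_verts N - I. \<forall>v \<in> I. (u, v) \<notin> parcs (net_graph N)"
  shows "(x, x') \<in> parcs (astg (subnet N I)) \<longleftrightarrow> x \<in> states I \<and> (\<exists>v\<in>I. x' = x(v := \<not> x v) \<and>
    net_fun N v (restrict (override_on y x I) (in_nbrs (net_graph N) v)) \<noteq> x v)"
proof -
  interpret pair_fin_digraph "net_graph N"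
    using assms(1) by (simp add: boolean_network_def)
  have "restrict x (in_nbrs (induced (net_graph N) I) v) =
      restrict (override_on y x I) (in_nbrs (net_graph N) v)" if "v \<in> I" for v
  proof
    fix u
    have "u \<in> I" if "(u, v) \<in> parcs (net_graph N)"
      using assms(3) \<open>v \<in> I\<close> that in_arcsD1[OF that] by auto
    then show "restrict x (in_nbrs (induced (net_graph N) I) v) u =
        restrict (override_on y x I) (in_nbrs (net_graph N) v) u"
      using \<open>v \<in> I\<close> by (auto simp: in_nbrs_def induced_def override_on_def restrict_def)
  qed
  then show ?thesis
    unfolding arc_astg_iff net_verts_subnet by (auto simp: subnet_def)
qed

text \<open>Every in-neighbour is a vertex: those in \<open>I\<close> are read from
  \<open>x\<close>, and those outside survive the restriction to the induced graph, so restricting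
  \<open>y\<close> first loses nothing.\<close>

lemma arc_fix_state_iff:
  assumes "boolean_network N"
  shows "(y, y') \<in> parcs (astg (fix_state N I x)) \<longleftrightarrow> y \<in> states (net_verts N - I) \<and>
    (\<exists>v\<in>net_verts N - I. y' = y(v := \<not> y v) \<and>
      net_fun N v (restrict (override_on y x I) (in_nbrs (net_graph N) v)) \<noteq> y v)"
proof -
  interpret pair_fin_digraph "net_graph N"
    using assms by (simp add: boolean_network_def)
  have "restrict (override_on (restrict y (in_nbrs (induced (net_graph N) (net_verts N - I)) v)) x I)
        (in_nbrs (net_graph N) v) = restrict (override_on y x I) (in_nbrs (net_graph N) v)"
    if "v \<in> net_verts N - I" for v
    using that by (auto simp: fun_eq_iff in_nbrs_def induced_def override_on_def restrict_def
        dest: in_arcsD1)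
  then show ?thesis
    unfolding arc_astg_iff net_verts_fix_state by (auto simp: fix_state_def)
qed

text \<open>Flipping \<open>v\<close> in a glued state flips it in exactly one of the two parts, and
  both arc characterisations test the local function at that same glued state. Hence
  \<open>v \<in> I\<close> gives the base steps and \<open>v \<notin> I\<close> the fibre
  steps.\<close>

lemma skew_product_astg:
  assumes N: "boolean_network N" and I: "I \<subseteq> net_verts N"
    and no_arc: "\<forall>u \<in> net_verts N - I. \<forall>v \<in> I. (u, v) \<notin> parcs (net_graph N)"
  shows "skew_product (states I) (states (net_verts N - I)) (parcs (astg (subnet N I)))
    (\<lambda>x. parcs (astg (fix_state N I x))) (parcs (astg N)) (\<lambda>x y. override_on y x I)"
proof
  show "parcs (astg (subnet N I)) \<subseteq> states I \<times> states I"
    by (auto simp: astg_def)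
  show "parcs (astg (fix_state N I x)) \<subseteq> states (net_verts N - I) \<times> states (net_verts N - I)" for x
    by (auto simp: astg_def)
  show "inj_on (\<lambda>(x, y). override_on y x I) (states I \<times> states (net_verts N - I))"
    using bij_betw_glue[OF I] by (rule bij_betw_imp_inj_on)
next
  fix x x' y assume xx': "(x, x') \<in> parcs (astg (subnet N I))" and y: "y \<in> states (net_verts N - I)"
  then obtain v where v: "x \<in> states I" "v \<in> I" "x' = x(v := \<not> x v)"
      "net_fun N v (restrict (override_on y x I) (in_nbrs (net_graph N) v)) \<noteq> x v"
    using arc_subnet_iff[OF assms, of x x' y] by blast
  then have "override_on y x' I = (override_on y x I)(v := \<not> override_on y x I v)"
    by (simp add: override_on_upd_in)
  with v I y show "(override_on y x I, override_on y x' I) \<in> parcs (astg N)"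
    unfolding arc_astg_iff by (intro conjI bexI[of _ v]) (simp_all add: glue_in_states subsetD)
next
  fix x y y' assume "(y, y') \<in> parcs (astg (fix_state N I x))" and x: "x \<in> states I"
  then obtain v where v: "y \<in> states (net_verts N - I)" "v \<in> net_verts N - I" "y' = y(v := \<not> y v)"
      "net_fun N v (restrict (override_on y x I) (in_nbrs (net_graph N) v)) \<noteq> y v"
    using arc_fix_state_iff[OF N, of y y'] by blast
  then have "override_on y' x I = (override_on y x I)(v := \<not> override_on y x I v)"
    by (simp add: override_on_upd_notin)
  with v I x show "(override_on y x I, override_on y' x I) \<in> parcs (astg N)"
    unfolding arc_astg_iff by (intro conjI bexI[of _ v]) (simp_all add: glue_in_states subsetD)
next
  fix x y z assume "(override_on y x I, z) \<in> parcs (astg N)"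
    and x: "x \<in> states I" and y: "y \<in> states (net_verts N - I)"
  then obtain v where v: "v \<in> net_verts N" "z = (override_on y x I)(v := \<not> override_on y x I v)"
      "net_fun N v (restrict (override_on y x I) (in_nbrs (net_graph N) v)) \<noteq> override_on y x I v"
    unfolding arc_astg_iff by blast
  show "(\<exists>x'. (x, x') \<in> parcs (astg (subnet N I)) \<and> z = override_on y x' I) \<or>
      (\<exists>y'. (y, y') \<in> parcs (astg (fix_state N I x)) \<and> z = override_on y' x I)"
  proof (cases "v \<in> I")
    case True
    then have "(x, x(v := \<not> x v)) \<in> parcs (astg (subnet N I))"
      using arc_subnet_iff[OF assms, of x _ y] v x by auto
    moreover have "z = override_on y (x(v := \<not> x v)) I"
      using True v(2) by (simp add: override_on_upd_in)
    ultimately show ?thesis by blast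
  next
    case False
    then have "(y, y(v := \<not> y v)) \<in> parcs (astg (fix_state N I x))"
      using arc_fix_state_iff[OF N, of y] v y by auto
    moreover have "z = override_on (y(v := \<not> y v)) x I"
      using False v(2) by (simp add: override_on_upd_notin)
    ultimately show ?thesis by blast
  qed
qed

section \<open>Product decomposition of the attractors and its uniqueness\<close>

theorem theorem4:
  fixes N :: "'v bool_net" and I :: "'v set"
  assumes "boolean_network N"
    and "I \<noteq> {}" and "I \<subset> net_verts N"
    and "\<forall>u \<in> net_verts N - I. \<forall>v \<in> I. (u, v) \<notin> parcs (net_graph N)"
  shows "attractors N =
      {state_prod I a b | a b. a \<in> attractors (subnet N I) \<and> b \<in> attractors (fix_states N I a)}
    \<and> bij_betw (\<lambda>(a, b). state_prod I a b)
        (SIGMA a : attractors (subnet N I). attractors (fix_states N I a)) (attractors N)"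
proof -
  have I: "I \<subseteq> net_verts N" using assms(3) by blast
  let ?V = "net_verts N"
  interpret skew_product "states I" "states (?V - I)" "parcs (astg (subnet N I))"
    "\<lambda>x. parcs (astg (fix_state N I x))" "parcs (astg N)" "\<lambda>x y. override_on y x I"
    using skew_product_astg[OF assms(1) I assms(4)] .
  have base: "a \<in> attractors (subnet N I) \<longleftrightarrow>
      a \<subseteq> states I \<and> terminal_class (parcs (astg (subnet N I))) a" for a
    by (simp add: attractors_eq)
  have fibre: "b \<in> attractors (fix_states N I a) \<longleftrightarrow> b \<subseteq> states (?V - I) \<and>
      terminal_class (\<Union>x\<in>a. parcs (astg (fix_state N I x))) b" for a b
    by (simp add: attractors_eq astg_fix_states)
  have glue: "(\<lambda>(x, y). override_on y x I) ` (states I \<times> states (?V - I)) = states ?V"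
    using bij_betw_glue[OF I] by (rule bij_betw_imp_surj_on)
  have eq: "attractors N =
      {state_prod I a b | a b. a \<in> attractors (subnet N I) \<and> b \<in> attractors (fix_states N I a)}"
  proof (intro equalityI subsetI)
    fix A assume "A \<in> attractors N"
    then have "terminal_class (parcs (astg N)) A"
      "A \<subseteq> (\<lambda>(x, y). override_on y x I) ` (states I \<times> states (?V - I))"
      unfolding glue by (simp_all add: attractors_eq)
    from terminal_class_is_product[OF this] show "A \<in> {state_prod I a b | a b.
        a \<in> attractors (subnet N I) \<and> b \<in> attractors (fix_states N I a)}"
      unfolding base fibre state_prod_def by blast
  next
    fix A assume "A \<in> {state_prod I a b | a b.
        a \<in> attractors (subnet N I) \<and> b \<in> attractors (fix_states N I a)}"
    then obtain a b where A: "A = (\<lambda>(x, y). override_on y x I) ` (a \<times> b)"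
      and a: "a \<subseteq> states I" "terminal_class (parcs (astg (subnet N I))) a"
      and b: "b \<subseteq> states (?V - I)" "terminal_class (\<Union>x\<in>a. parcs (astg (fix_state N I x))) b"
      unfolding base fibre state_prod_def by blast
    have "A \<subseteq> states ?V" unfolding A glue[symmetric] using a(1) b(1) by blast
    with terminal_class_product[OF a(2,1) b(2,1)] show "A \<in> attractors N"
      by (simp add: attractors_eq A)
  qed
  have "inj_on (\<lambda>(a, b). state_prod I a b)
      (SIGMA a : attractors (subnet N I). attractors (fix_states N I a))"
  proof (rule inj_onI, clarsimp)
    fix a b a' b'
    assume "a \<in> attractors (subnet N I)" "b \<in> attractors (fix_states N I a)"
      and "a' \<in> attractors (subnet N I)" "b' \<in> attractors (fix_states N I a')"
      and prod: "state_prod I a b = state_prod I a' b'"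
    then have sub: "a \<times> b \<subseteq> states I \<times> states (?V - I)" "a' \<times> b' \<subseteq> states I \<times> states (?V - I)"
      and ne: "a \<noteq> {}" "b \<noteq> {}"
      unfolding base fibre by (auto dest: terminal_class_nonempty)
    \<comment> \<open>Gluing is injective on pairs of states, so equal images come from equal
      products; a product determines its factors once they are non-empty, as attractors are.\<close>
    have "a \<times> b = a' \<times> b'"
      using inj_on_image_eq_iff[OF g_inj sub] prod by (simp add: state_prod_def)
    with ne show "a = a' \<and> b = b'" by (auto simp: times_eq_iff)
  qed
  moreover have "(\<lambda>(a, b). state_prod I a b) `
      (SIGMA a : attractors (subnet N I). attractors (fix_states N I a)) = attractors N"
    unfolding eq by force
  ultimately show ?thesis using eq by (simp add: bij_betw_def)
qed

end
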